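(* Let $O:=\{x\in S : \bar L(x,\infty)>0\}$. Assume that for any $y\in O$ and $x\in S$, we are given a path $\gamma_{y,x}$ in $S$ going from $y$ to $x$. Then we have $$a_\varphi\le\Big(\min_{y\in O,\ x\in S}P(\gamma_{y,x})\Big)^{-1}.$$
   Context: Setting: $S$ is a finite nonempty set, $\bar S:=S\sqcup\{\infty\}$, and $\bar L=(\bar L(x,y))_{x,y\in\bar S}$ is a Markov generator matrix (off-diagonal entries non-negative, each row sums to $0$). Its restriction $K$ to $S\times S$ is irreducible, $\bar L(\infty,x)=0$ for all $x\in\bar S$ (so $\infty$ is absorbing), and there exists $x\in S$ with $\bar L(x,\infty)>0$. By Perron-Frobenius, $-K$ has a unique eigenvalue $\lambda_0$ admitting a positive eigenvector; it is simple. Let $\varphi:S\to(0,\infty)$ be such an eigenvector: $K\varphi=-\lambda_0\varphi$. Its amplitude is $a_\varphi:=\max_{x\in S}\varphi(x)/\min_{x\in S}\varphi(x)$. A path in $S$ from $y$ to $x$ is a finite sequence $\gamma=(\gamma_0,\gamma_1,\dots,\gamma_l)$ of elements of $S$ with $\gamma_0=y$, $\gamma_l=x$ and $\bar L(\gamma_k,\gamma_{k+1})>0$ for all $0\le k\le l-1$ (with $l=0$ allowed when $y=x$). For such a path, $$P(\gamma):=\prod_{k=0}^{l-1}\frac{\bar L(\gamma_k,\gamma_{k+1})}{|\bar L(\gamma_k,\gamma_k)|-\lambda_0},$$ the empty product being $1$. *)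

theory Defs
  imports "HOL-Analysis.Analysis"
begin

(* The state space S is the finite type 'a (automatically nonempty); S together with the
   cemetery point is 'a option, the cemetery point being None. *)

definition markov_generator :: "real ^ ('s::finite) ^ 's \<Rightarrow> bool" where
  "markov_generator L \<longleftrightarrow>
     (\<forall>x y. x \<noteq> y \<longrightarrow> 0 \<le> L $ x $ y) \<and> (\<forall>x. (\<Sum>y\<in>UNIV. L $ x $ y) = 0)"

definition restrict_to_S :: "real ^ ('a::finite) option ^ 'a option \<Rightarrow> real ^ 'a ^ 'a" where
  "restrict_to_S L = (\<chi> x y. L $ Some x $ Some y)"

(* The list [g_0, ..., g_l] has length l + 1; the one-point path is allowed when y = x. *)
definition is_path :: "real ^ ('a::finite) ^ 'a \<Rightarrow> 'a \<Rightarrow> 'a \<Rightarrow> 'a list \<Rightarrow> bool" where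
  "is_path K y x g \<longleftrightarrow>
     g \<noteq> [] \<and> hd g = y \<and> last g = x \<and>
     (\<forall>k < length g - 1. K $ (g ! k) $ (g ! Suc k) > 0)"

(* Irreducibility in the sense of Markov generators: a 1 x 1 matrix is irreducible. *)
definition irreducible_rates :: "real ^ ('a::finite) ^ 'a \<Rightarrow> bool" where
  "irreducible_rates K \<longleftrightarrow> (\<forall>y x. \<exists>g. is_path K y x g)"

definition path_weight :: "real ^ ('a::finite) ^ 'a \<Rightarrow> real \<Rightarrow> 'a list \<Rightarrow> real" where
  "path_weight K lam g =
     (\<Prod>k < length g - 1. K $ (g ! k) $ (g ! Suc k) / (\<bar>K $ (g ! k) $ (g ! k)\<bar> - lam))"

definition exit_set :: "real ^ ('a::finite) option ^ 'a option \<Rightarrow> 'a set" where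
  "exit_set L = {x. L $ Some x $ None > 0}"

definition amplitude :: "real ^ ('a::finite) \<Rightarrow> real" where
  "amplitude \<phi> = (MAX x. \<phi> $ x) / (MIN x. \<phi> $ x)"

end

theory Submission
  imports Defs
begin

text \<open>
  Write \<open>K\<close> for the restriction to \<open>S\<close>, so that \<open>K \<phi> = - \<lambda>\<^sub>0 \<phi>\<close> with \<open>\<phi> > 0\<close>. Two facts give the
  bound.

  Along a path, \<open>\<phi>\<close> loses at most the factor \<open>P(\<gamma>)\<close>. The equation at \<open>x\<close> reads
  \<open>(\<bar>K(x,x)\<bar> - \<lambda>\<^sub>0) \<phi>(x) = (\<Sum>z\<noteq>x. K(x,z) \<phi>(z))\<close>, and keeping a single term of the right-hand side
  gives \<open>\<phi>(x) \<ge> K(x,z) / (\<bar>K(x,x)\<bar> - \<lambda>\<^sub>0) \<phi>(z)\<close>, with a positive denominator as soon as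
  \<open>K(x,z) > 0\<close>. Multiplying these inequalities over the edges of a path from \<open>y\<close> to \<open>x\<close> yields
  \<open>\<phi>(y) \<ge> P(\<gamma>) \<phi>(x)\<close> (lemma \<open>path_weight_comparison\<close>).

  The minimum of \<open>\<phi>\<close> is attained on the exit set \<open>O\<close> (lemma \<open>minimizer_in_exit_set\<close>). The equation
  at a maximum point forces \<open>\<lambda>\<^sub>0 \<ge> 0\<close>, so \<open>\<phi>\<close> is superharmonic. At a point outside \<open>O\<close> the rates of
  \<open>K\<close> sum to \<open>0\<close>, so there the minimum principle applies: a minimum point outside \<open>O\<close> passes its
  minimality on to all its neighbours. Since \<open>O\<close> can be reached from everywhere, some minimum point
  lies in \<open>O\<close>.

  It remains to apply the first fact to the path from a minimum point \<open>y\<close> in \<open>O\<close> to a maximum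
  point \<open>x\<close> of \<open>\<phi>\<close>.
\<close>

section \<open>The sub-Markovian generator on the transient states\<close>

lemma sum_UNIV_option:
  fixes f :: "'a::finite option \<Rightarrow> real"
  shows "(\<Sum>z\<in>UNIV. f z) = f None + (\<Sum>z\<in>UNIV. f (Some z))"
  by (simp add: UNIV_option_conv sum.reindex)

lemma restrict_to_S_nth [simp]: "restrict_to_S L $ x $ y = L $ Some x $ Some y"
  by (simp add: restrict_to_S_def)

lemma restrict_to_S_off_diagonal_nonneg:
  assumes "markov_generator L" "x \<noteq> y"
  shows "restrict_to_S L $ x $ y \<ge> 0"
  using assms by (simp add: markov_generator_def)

lemma restrict_to_S_row_sum:
  assumes "markov_generator L"
  shows "(\<Sum>z\<in>UNIV. restrict_to_S L $ x $ z) = - L $ Some x $ None"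
proof -
  have "(\<Sum>z\<in>UNIV. L $ Some x $ z) = 0"
    using assms by (simp add: markov_generator_def)
  then show ?thesis
    by (simp add: sum_UNIV_option)
qed

lemma exit_rate_nonneg:
  assumes "markov_generator L"
  shows "L $ Some x $ None \<ge> 0"
  using assms by (simp add: markov_generator_def)

lemma restrict_to_S_diagonal_nonpos:
  assumes "markov_generator L"
  shows "restrict_to_S L $ x $ x \<le> 0"
proof -
  have "0 \<le> (\<Sum>z\<in>UNIV - {x}. restrict_to_S L $ x $ z)"
    by (intro sum_nonneg restrict_to_S_off_diagonal_nonneg[OF assms]) auto
  then show ?thesis
    using restrict_to_S_row_sum[OF assms, of x] exit_rate_nonneg[OF assms, of x]
    by (simp add: sum.remove[of UNIV x])
qed

section \<open>Comparison of eigenvector values along paths\<close>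

lemma eigenvector_equation:
  fixes K :: "real ^ 'a::finite ^ 'a"
  assumes "K *v \<phi> = - lam *\<^sub>R \<phi>"
  shows "(\<Sum>z\<in>UNIV. K $ x $ z * \<phi> $ z) = - lam * \<phi> $ x"
  using arg_cong[OF assms, of "\<lambda>v. v $ x"] by (simp add: matrix_vector_mult_def)

text \<open>
  Discarding all but one term of the eigenvector equation. The positivity of the denominator is part
  of the conclusion because \<open>lam\<close> is not assumed to lie below the numbers \<open>\<bar>K(x,x)\<bar>\<close>; it follows from
  the presence of a positive term.
\<close>

lemma edge_comparison:
  fixes K :: "real ^ 'a::finite ^ 'a"
  assumes off_diag: "\<And>x y. x \<noteq> y \<Longrightarrow> K $ x $ y \<ge> 0"
    and diag: "\<And>x. K $ x $ x \<le> 0"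
    and pos: "\<And>x. \<phi> $ x > 0"
    and eigen: "K *v \<phi> = - lam *\<^sub>R \<phi>"
    and edge: "K $ x $ y > 0"
  shows "\<bar>K $ x $ x\<bar> - lam > 0"
    and "K $ x $ y / (\<bar>K $ x $ x\<bar> - lam) * \<phi> $ y \<le> \<phi> $ x"
proof -
  have "x \<noteq> y"
    using diag[of x] edge by auto
  have "K $ x $ y * \<phi> $ y \<le> (\<Sum>z\<in>UNIV - {x}. K $ x $ z * \<phi> $ z)"
    using \<open>x \<noteq> y\<close> off_diag pos by (intro member_le_sum) (auto simp: less_imp_le)
  also have "\<dots> = (\<bar>K $ x $ x\<bar> - lam) * \<phi> $ x"
    using eigenvector_equation[OF eigen, of x] diag[of x]
    by (simp add: sum.remove[of UNIV x] algebra_simps)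
  finally have le: "K $ x $ y * \<phi> $ y \<le> (\<bar>K $ x $ x\<bar> - lam) * \<phi> $ x" .
  have "0 < K $ x $ y * \<phi> $ y"
    using edge pos by simp
  with le have "0 < (\<bar>K $ x $ x\<bar> - lam) * \<phi> $ x"
    by linarith
  then show denom: "\<bar>K $ x $ x\<bar> - lam > 0"
    using pos[of x] zero_less_mult_pos2 by blast
  show "K $ x $ y / (\<bar>K $ x $ x\<bar> - lam) * \<phi> $ y \<le> \<phi> $ x"
    using le denom by (simp add: field_simps)
qed

text \<open>The one-edge inequalities telescope along a path.\<close>

lemma path_weight_comparison:
  fixes K :: "real ^ 'a::finite ^ 'a"
  assumes off_diag: "\<And>x y. x \<noteq> y \<Longrightarrow> K $ x $ y \<ge> 0"
    and diag: "\<And>x. K $ x $ x \<le> 0"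
    and pos: "\<And>x. \<phi> $ x > 0"
    and eigen: "K *v \<phi> = - lam *\<^sub>R \<phi>"
    and path: "is_path K y x g"
  shows "path_weight K lam g > 0"
    and "path_weight K lam g * \<phi> $ x \<le> \<phi> $ y"
proof -
  define w where "w k = K $ (g ! k) $ (g ! Suc k) / (\<bar>K $ (g ! k) $ (g ! k)\<bar> - lam)" for k
  have edge: "K $ (g ! k) $ (g ! Suc k) > 0" if "k < length g - 1" for k
    using path that by (simp add: is_path_def)
  have ends: "g ! 0 = y" "g ! (length g - 1) = x"
    using path by (auto simp: is_path_def hd_conv_nth last_conv_nth)
  have w_pos: "w k > 0" if "k < length g - 1" for k
    using edge[OF that] edge_comparison(1)[OF off_diag diag pos eigen edge[OF that]]
    by (simp add: w_def)
  have prod_pos: "(\<Prod>k<n. w k) > 0" if "n \<le> length g - 1" for n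
    using that w_pos by (intro prod_pos) auto
  have "(\<Prod>k<n. w k) * \<phi> $ (g ! n) \<le> \<phi> $ (g ! 0)" if "n \<le> length g - 1" for n
    using that
  proof (induction n)
    case 0
    then show ?case by simp
  next
    case (Suc n)
    have "w n * \<phi> $ (g ! Suc n) \<le> \<phi> $ (g ! n)"
      unfolding w_def
      using edge_comparison(2)[OF off_diag diag pos eigen edge[of n]] Suc.prems by simp
    then have "(\<Prod>k<n. w k) * (w n * \<phi> $ (g ! Suc n)) \<le> (\<Prod>k<n. w k) * \<phi> $ (g ! n)"
      using prod_pos[of n] Suc.prems by (intro mult_left_mono) auto
    also have "\<dots> \<le> \<phi> $ (g ! 0)"
      using Suc by simp
    finally show ?case
      by (simp add: mult.assoc)
  qed
  from this[of "length g - 1"] have "(\<Prod>k<length g - 1. w k) * \<phi> $ x \<le> \<phi> $ y"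
    unfolding ends by simp
  then show "path_weight K lam g * \<phi> $ x \<le> \<phi> $ y"
    by (simp add: path_weight_def w_def)
  show "path_weight K lam g > 0"
    using prod_pos[of "length g - 1"] by (simp add: path_weight_def w_def)
qed

section \<open>The minimum principle\<close>

text \<open>
  Centring the eigenvector equation at \<open>x\<close> makes the diagonal term vanish, so that at an extremum of
  \<open>\<phi>\<close> all terms of the sum have the same sign.
\<close>

lemma centred_eigenvector_equation:
  fixes L :: "real ^ ('a::finite) option ^ 'a option"
  assumes "markov_generator L" "restrict_to_S L *v \<phi> = - lam *\<^sub>R \<phi>"
  shows "(\<Sum>z\<in>UNIV. restrict_to_S L $ x $ z * (\<phi> $ z - \<phi> $ x))
    = (L $ Some x $ None - lam) * \<phi> $ x"
proof -
  have "(\<Sum>z\<in>UNIV. restrict_to_S L $ x $ z * (\<phi> $ z - \<phi> $ x))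
      = (\<Sum>z\<in>UNIV. restrict_to_S L $ x $ z * \<phi> $ z) - (\<Sum>z\<in>UNIV. restrict_to_S L $ x $ z) * \<phi> $ x"
    by (simp only: right_diff_distrib sum_subtractf sum_distrib_right)
  then show ?thesis
    unfolding eigenvector_equation[OF assms(2)] restrict_to_S_row_sum[OF assms(1)]
    by (simp add: algebra_simps)
qed

text \<open>
  At a maximum point \<open>x\<close> the centred sum is nonpositive, and equals the exit rate minus \<open>lam\<close>, up to
  the factor \<open>\<phi>(x) > 0\<close>; hence \<open>lam\<close> dominates an exit rate, which is nonnegative.
\<close>

lemma eigenvalue_nonneg:
  fixes L :: "real ^ ('a::finite) option ^ 'a option"
  assumes gen: "markov_generator L"
    and pos: "\<And>x. \<phi> $ x > 0"
    and eigen: "restrict_to_S L *v \<phi> = - lam *\<^sub>R \<phi>"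
  shows "lam \<ge> 0"
proof -
  have "Max (range (($) \<phi>)) \<in> range (($) \<phi>)"
    by (rule Max_in) auto
  then obtain x where x: "\<phi> $ x = Max (range (($) \<phi>))"
    by (metis imageE)
  have "restrict_to_S L $ x $ z * (\<phi> $ z - \<phi> $ x) \<le> 0" for z
  proof (cases "z = x")
    case False
    moreover have "\<phi> $ z \<le> \<phi> $ x"
      by (simp add: x)
    ultimately show ?thesis
      using restrict_to_S_off_diagonal_nonneg[OF gen, of x z]
      by (intro mult_nonneg_nonpos) auto
  qed simp
  then have "(L $ Some x $ None - lam) * \<phi> $ x \<le> 0"
    unfolding centred_eigenvector_equation[OF gen eigen, symmetric] by (intro sum_nonpos) auto
  then have "L $ Some x $ None \<le> lam"
    using pos[of x] by (simp add: mult_le_0_iff)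
  then show ?thesis
    using exit_rate_nonneg[OF gen, of x] by linarith
qed

text \<open>
  Minimum principle: outside the exit set the centred sum at a minimum point is a sum of nonnegative
  terms with nonpositive total \<open>- lam * \<phi>(x)\<close>, so every term vanishes.
\<close>

lemma minimum_propagates_outside_exit_set:
  fixes L :: "real ^ ('a::finite) option ^ 'a option"
  assumes gen: "markov_generator L"
    and pos: "\<And>x. \<phi> $ x > 0"
    and eigen: "restrict_to_S L *v \<phi> = - lam *\<^sub>R \<phi>"
    and x: "x \<notin> exit_set L" "\<And>z. \<phi> $ x \<le> \<phi> $ z"
    and edge: "restrict_to_S L $ x $ y > 0"
  shows "\<phi> $ y = \<phi> $ x"
proof -
  let ?t = "\<lambda>z. restrict_to_S L $ x $ z * (\<phi> $ z - \<phi> $ x)"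
  have nonneg: "?t z \<ge> 0" for z
  proof (cases "z = x")
    case False
    then show ?thesis
      using restrict_to_S_off_diagonal_nonneg[OF gen, of x z] x(2)[of z]
      by (intro mult_nonneg_nonneg) auto
  qed simp
  have "L $ Some x $ None = 0"
    using x(1) exit_rate_nonneg[OF gen, of x] by (simp add: exit_set_def)
  then have "(\<Sum>z\<in>UNIV. ?t z) \<le> 0"
    using centred_eigenvector_equation[OF gen eigen, of x] pos[of x]
      eigenvalue_nonneg[OF gen pos eigen] by simp
  moreover have "?t y \<le> (\<Sum>z\<in>UNIV. ?t z)"
    using nonneg by (intro member_le_sum) auto
  ultimately have "?t y = 0"
    using nonneg[of y] by linarith
  with edge show ?thesis
    by simp
qed

text \<open>
  Were no minimum point in the exit set, minimality would be inherited along every path, in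
  particular along one that leads from a minimum point into the exit set.
\<close>

lemma minimizer_in_exit_set:
  fixes L :: "real ^ ('a::finite) option ^ 'a option"
  assumes gen: "markov_generator L"
    and irred: "irreducible_rates (restrict_to_S L)"
    and exit: "o' \<in> exit_set L"
    and pos: "\<And>x. \<phi> $ x > 0"
    and eigen: "restrict_to_S L *v \<phi> = - lam *\<^sub>R \<phi>"
  obtains y where "y \<in> exit_set L" "\<phi> $ y = (MIN x. \<phi> $ x)"
proof (rule ccontr)
  let ?m = "MIN x. \<phi> $ x"
  assume "\<not> thesis"
  then have outside: "y \<notin> exit_set L" if "\<phi> $ y = ?m" for y
    using that \<open>\<And>y. y \<in> exit_set L \<Longrightarrow> \<phi> $ y = ?m \<Longrightarrow> thesis\<close> by blast
  have step: "\<phi> $ v = ?m" if "\<phi> $ u = ?m" "restrict_to_S L $ u $ v > 0" for u v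
    using minimum_propagates_outside_exit_set[OF gen pos eigen outside[OF that(1)] _ that(2)]
    by (simp add: that(1))
  have "?m \<in> range (($) \<phi>)"
    by (rule Min_in) auto
  then obtain x where x: "\<phi> $ x = ?m"
    by (metis imageE)
  obtain g where g: "is_path (restrict_to_S L) x o' g"
    using irred by (auto simp: irreducible_rates_def)
  have "\<phi> $ (g ! n) = ?m" if "n \<le> length g - 1" for n
    using that
  proof (induction n)
    case 0
    then show ?case
      using g x by (metis is_path_def hd_conv_nth)
  next
    case (Suc n)
    then show ?case
      using g step[of "g ! n" "g ! Suc n"] by (simp add: is_path_def)
  qed
  from this[of "length g - 1"] have "\<phi> $ o' = ?m"
    using g by (auto simp: is_path_def last_conv_nth)
  with outside exit show False
    by blast
qed

section \<open>The amplitude bound\<close>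

theorem proposition2:
  fixes L :: "real ^ ('a::finite) option ^ 'a option"
    and \<phi> :: "real ^ 'a"
    and lam0 :: real
    and \<gamma> :: "'a \<Rightarrow> 'a \<Rightarrow> 'a list"
  assumes "markov_generator L"
    and "irreducible_rates (restrict_to_S L)"
    and "\<forall>x. L $ None $ x = 0"
    and "\<exists>x. L $ Some x $ None > 0"
    and "\<forall>x. \<phi> $ x > 0"
    and "restrict_to_S L *v \<phi> = - lam0 *\<^sub>R \<phi>"
    and "\<forall>y \<in> exit_set L. \<forall>x. is_path (restrict_to_S L) y x (\<gamma> y x)"
  shows "amplitude \<phi> \<le>
    inverse (MIN (y, x) \<in> exit_set L \<times> UNIV. path_weight (restrict_to_S L) lam0 (\<gamma> y x))"
proof -
  let ?K = "restrict_to_S L"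
  let ?W = "(\<lambda>(y, x). path_weight ?K lam0 (\<gamma> y x)) ` (exit_set L \<times> UNIV)"
  note gen = assms(1) and eigen = assms(6) and paths = assms(7)
  have pos: "\<phi> $ x > 0" for x
    using assms(5) by blast
  note comparison =
    path_weight_comparison[OF restrict_to_S_off_diagonal_nonneg[OF gen]
      restrict_to_S_diagonal_nonpos[OF gen] pos eigen]
  obtain y0 where "y0 \<in> exit_set L"
    using assms(4) by (auto simp: exit_set_def)
  then obtain y where y: "y \<in> exit_set L" "\<phi> $ y = (MIN x. \<phi> $ x)"
    using minimizer_in_exit_set[OF gen assms(2) _ pos eigen] by blast
  have "(MAX x. \<phi> $ x) \<in> range (($) \<phi>)"
    by (rule Max_in) auto
  then obtain x where x: "\<phi> $ x = (MAX x. \<phi> $ x)"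
    by (metis imageE)
  have "Min ?W \<in> ?W"
    using y(1) by (intro Min_in) auto
  then have min_pos: "Min ?W > 0"
    using comparison(1) paths by fastforce
  have "Min ?W \<le> path_weight ?K lam0 (\<gamma> y x)"
    using y(1) by (intro Min_le) auto
  then have "Min ?W * \<phi> $ x \<le> path_weight ?K lam0 (\<gamma> y x) * \<phi> $ x"
    using pos[of x] by (intro mult_right_mono) auto
  also have "\<dots> \<le> \<phi> $ y"
    using comparison(2) paths y(1) by blast
  finally have "\<phi> $ x / \<phi> $ y \<le> inverse (Min ?W)"
    using pos[of y] min_pos by (simp add: field_simps)
  then show ?thesis
    by (simp only: amplitude_def x y(2))
qed

end
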